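(* Let $(X,0,\prec)$ be a $\mathrm{W}$-set and let $R$ be a left $\prec$-continuous relation on $X$. For any $a,b\in X$, the following statements are equivalent: (i) $a\leq^{R}b$; (ii) for any $c\in X$ with $c\prec a$, either $c\prec b$, or else there are $n\geq1$ and $d_1,\dots,d_n,e_1,\dots,e_n\in X$ such that $$c\prec d_1\,R\,e_1\prec d_2\,R\,e_2\prec\dots\prec d_n\,R\,e_n\prec b.$$
   Context: For a relation $\prec$ on a set $X$, $a^\prec=\{b\in X:b\prec a\}$. For relations, $(a,b)\in R_1\circ R_2$ iff there is $c$ with $a\,R_1\,c$ and $c\,R_2\,b$ (similarly for longer compositions). A $\mathrm{W}$-set $(X,0,\prec)$ is a pointed set $(X,0)$ with a transitive relation $\prec$ such that $0\prec a$ for all $a\in X$ and (W1): for each $a\in X$ there is a sequence $(a_k)$ in $a^\prec$ with $a_k\prec a_{k+1}$ for all $k$ and such that every $b\prec a$ satisfies $b\prec a_k$ for some $k$. A relation $R$ on $X$ is left $\prec$-continuous if $\prec\circ R\subseteq\prec\circ R\circ\prec$. $\leq^R$ denotes the smallest preorder $\leq$ on $X$ such that, for all $a,b\in X$, any of the following implies $a\leq b$: $a^\prec\subseteq b^\prec$; $(a,b)\in R$; $c\leq b$ for all $c\prec a$. (It exists, as the collection of such preorders is closed under intersections.) *)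

theory Defs
  imports Main
begin

text \<open>
  Relations on \<^term>\<open>X\<close> are sets of pairs contained in \<^term>\<open>X \<times> X\<close>. The set of all
  \<^term>\<open>b\<close> with \<^term>\<open>(b, a) \<in> prec\<close> is \<^term>\<open>under prec a\<close>, and composition is \<^const>\<open>relcomp\<close>
  (written \<open>O\<close>), which composes from left to right. The relation \<^term>\<open>prec\<close> need not be irreflexive.
\<close>

locale W_set =
  fixes X :: "'a set" and zero :: 'a and prec :: "('a \<times> 'a) set"
  assumes zero_in: "zero \<in> X"
    and prec_on: "prec \<subseteq> X \<times> X"
    and prec_trans: "trans prec"
    and zero_prec: "\<And>a. a \<in> X \<Longrightarrow> (zero, a) \<in> prec"
    and W1: "\<And>a. a \<in> X \<Longrightarrow>
      \<exists>s :: nat \<Rightarrow> 'a. (\<forall>k. s k \<in> under prec a) \<and> (\<forall>k. (s k, s (Suc k)) \<in> prec) \<and>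
        (\<forall>b \<in> under prec a. \<exists>k. (b, s k) \<in> prec)"

definition left_continuous :: "('a \<times> 'a) set \<Rightarrow> ('a \<times> 'a) set \<Rightarrow> bool" where
  "left_continuous prec R \<longleftrightarrow> prec O R \<subseteq> prec O R O prec"

definition admissible_preorder ::
    "'a set \<Rightarrow> ('a \<times> 'a) set \<Rightarrow> ('a \<times> 'a) set \<Rightarrow> ('a \<times> 'a) set \<Rightarrow> bool" where
  "admissible_preorder X prec R S \<longleftrightarrow>
     preorder_on X S \<and>
     (\<forall>a\<in>X. \<forall>b\<in>X. under prec a \<subseteq> under prec b \<longrightarrow> (a, b) \<in> S) \<and>
     (\<forall>a\<in>X. \<forall>b\<in>X. (a, b) \<in> R \<longrightarrow> (a, b) \<in> S) \<and>
     (\<forall>a\<in>X. \<forall>b\<in>X. (\<forall>c \<in> under prec a. (c, b) \<in> S) \<longrightarrow> (a, b) \<in> S)"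

definition leq_rel :: "'a set \<Rightarrow> ('a \<times> 'a) set \<Rightarrow> ('a \<times> 'a) set \<Rightarrow> ('a \<times> 'a) set" where
  "leq_rel X prec R = \<Inter>{S. admissible_preorder X prec R S}"

text \<open>\<^const>\<open>leq_rel\<close> is indeed the smallest preorder with the three closure properties.\<close>

lemma admissible_preorder_full: "admissible_preorder X prec R (X \<times> X)"
  by (auto simp: admissible_preorder_def preorder_on_def refl_on_def trans_def)

lemma leq_rel_least:
  assumes "admissible_preorder X prec R S"
  shows "leq_rel X prec R \<subseteq> S"
  using assms by (auto simp: leq_rel_def)

lemma leq_rel_admissible: "admissible_preorder X prec R (leq_rel X prec R)"
proof -
  have sub: "leq_rel X prec R \<subseteq> X \<times> X"
    by (rule leq_rel_least[OF admissible_preorder_full])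
  have refl: "refl_on X (leq_rel X prec R)"
    using sub by (auto simp: leq_rel_def refl_on_def admissible_preorder_def preorder_on_def)
  have "trans (leq_rel X prec R)"
    by (rule transI) (auto simp: leq_rel_def admissible_preorder_def preorder_on_def dest: transD)
  with sub refl have pre: "preorder_on X (leq_rel X prec R)"
    by (simp add: preorder_on_def)
  have "(a, b) \<in> leq_rel X prec R"
    if "a \<in> X" "b \<in> X" "\<forall>c \<in> under prec a. (c, b) \<in> leq_rel X prec R" for a b
    using that unfolding leq_rel_def admissible_preorder_def by blast
  with pre show ?thesis
    unfolding admissible_preorder_def[of _ _ _ "leq_rel X prec R"]
    by (auto simp: leq_rel_def admissible_preorder_def)
qed

end

theory Submission
  imports Defs
begin

text \<open>
  Condition (ii) says that every \<open>c \<prec> a\<close> is related to \<open>b\<close> by \<open>T = (\<prec> \<circ> R)\<^sup>* \<circ> \<prec>\<close>.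
  The relation on \<open>X\<close> so defined is itself an admissible preorder: transitivity holds because
  the starred factors can be concatenated, it contains \<open>R\<close> by left continuity, and closure under
  the third rule follows from interpolation, \<open>c \<prec> a\<close> giving \<open>c \<prec> a\<^sub>k \<prec> a\<close> by (W1).
  Conversely every admissible preorder contains \<open>\<prec>\<close> and \<open>R\<close>, hence \<open>T\<close>, and the third rule
  then yields \<open>a \<le> b\<close>.
\<close>

text \<open>A path of \<open>Suc m\<close> steps in \<open>P O R\<close> has its successive
  endpoints as the \<open>e i\<close>, and the midpoint of each step, where \<open>P\<close> hands
  over to \<open>R\<close>, as \<open>d i\<close>.\<close>

lemma relpow_relcomp_conv_alternating:
  "(c, b) \<in> (P O R) ^^ Suc m O P \<longleftrightarrow>
    (\<exists>d e. (c, d 1) \<in> P \<and> (\<forall>i\<in>{1..Suc m}. (d i, e i) \<in> R) \<and>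
       (\<forall>i\<in>{1..<Suc m}. (e i, d (i + 1)) \<in> P) \<and> (e (Suc m), b) \<in> P)" (is "?L \<longleftrightarrow> ?R")
proof
  assume ?L
  then obtain f where f: "f 0 = c" "(f (Suc m), b) \<in> P"
      "\<And>i. i < Suc m \<Longrightarrow> (f i, f (Suc i)) \<in> P O R"
    by (auto simp only: relpow_fun_conv relcomp_unfold)
  then have "\<forall>i. \<exists>y. i < Suc m \<longrightarrow> (f i, y) \<in> P \<and> (y, f (Suc i)) \<in> R"
    by blast
  then obtain g where g: "\<And>i. i < Suc m \<Longrightarrow> (f i, g i) \<in> P \<and> (g i, f (Suc i)) \<in> R"
    by metis
  show ?R
  \<comment> \<open>The midpoints \<open>g\<close> are numbered from 0 but \<open>d\<close> from 1,
    hence the shift; \<open>f\<close> already has the right numbering, since step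
    \<open>i - 1\<close> ends at \<open>f i\<close>.\<close>
  proof (intro exI[of _ "\<lambda>i. g (i - 1)"] exI[of _ f] conjI ballI)
    show "(c, g (1 - 1)) \<in> P"
      using g[of 0] f(1) by simp
    show "(g (i - 1), f i) \<in> R" if "i \<in> {1..Suc m}" for i
      using g[of "i - 1"] that by auto
    show "(f i, g (i + 1 - 1)) \<in> P" if "i \<in> {1..<Suc m}" for i
      using g[of i] that by simp
  qed (rule f(2))
next
  assume ?R
  then obtain d e where de: "(c, d 1) \<in> P" "\<And>i. i \<in> {1..Suc m} \<Longrightarrow> (d i, e i) \<in> R"
      "\<And>i. i \<in> {1..<Suc m} \<Longrightarrow> (e i, d (i + 1)) \<in> P" "(e (Suc m), b) \<in> P"
    by blast
  \<comment> \<open>The chain leaves \<open>e 0\<close> unconstrained, so it can be overwritten by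
    the starting point \<open>c\<close> to form the path.\<close>
  have "(e(0 := c)) i \<in> {x. (x, (e(0 := c)) (Suc i)) \<in> P O R}" if "i < Suc m" for i
    using that de(1) de(2)[of "Suc i"] de(3)[of i] by (cases i) auto
  then have "(c, e (Suc m)) \<in> (P O R) ^^ Suc m"
    unfolding relpow_fun_conv by (intro exI[of _ "e(0 := c)"]) auto
  then show ?L
    using de(4) by blast
qed

text \<open>Split the star by exponent: power 0 is the identity and leaves
  \<open>(c, b) \<in> P\<close>, while positive powers give chains with \<open>n \<ge> 1\<close>.
  All \<open>d i\<close>, \<open>e i\<close> lie in \<open>X\<close> because \<open>R\<close> is a
  relation on \<open>X\<close>.\<close>

lemma rtrancl_relcomp_conv_alternating:
  assumes "R \<subseteq> X \<times> X"
  shows "(c, b) \<in> (P O R)\<^sup>* O P \<longleftrightarrow>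
    (c, b) \<in> P \<or>
    (\<exists>(n::nat) d e. n \<ge> 1 \<and> (\<forall>i\<in>{1..n}. d i \<in> X \<and> e i \<in> X) \<and> (c, d 1) \<in> P \<and>
       (\<forall>i\<in>{1..n}. (d i, e i) \<in> R) \<and> (\<forall>i\<in>{1..<n}. (e i, d (i + 1)) \<in> P) \<and> (e n, b) \<in> P)"
    (is "_ \<longleftrightarrow> _ \<or> ?C")
proof -
  have "(c, b) \<in> (P O R)\<^sup>* O P \<longleftrightarrow> (\<exists>n. (c, b) \<in> (P O R) ^^ n O P)"
    unfolding rtrancl_power relcomp_unfold by blast
  also have "\<dots> \<longleftrightarrow> (c, b) \<in> P \<or> (\<exists>m. (c, b) \<in> (P O R) ^^ Suc m O P)"
    by (metis R_O_Id Id_O_R not0_implies_Suc relpow.simps(1))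
  also have "(\<exists>m. (c, b) \<in> (P O R) ^^ Suc m O P) \<longleftrightarrow> ?C"
  proof
    assume "\<exists>m. (c, b) \<in> (P O R) ^^ Suc m O P"
    then obtain m d e where "(c, d 1) \<in> P" "\<forall>i\<in>{1..Suc m}. (d i, e i) \<in> R"
        "\<forall>i\<in>{1..<Suc m}. (e i, d (i + 1)) \<in> P" "(e (Suc m), b) \<in> P"
      unfolding relpow_relcomp_conv_alternating by blast
    moreover from this(2) assms have "\<forall>i\<in>{1..Suc m}. d i \<in> X \<and> e i \<in> X"
      by blast
    ultimately show ?C
      by (intro exI[of _ "Suc m"] exI[of _ d] exI[of _ e]) simp
  next
    assume ?C
    then obtain n :: nat and d e where n: "n \<ge> 1" and de: "(c, d 1) \<in> P" "\<forall>i\<in>{1..n}. (d i, e i) \<in> R"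
        "\<forall>i\<in>{1..<n}. (e i, d (i + 1)) \<in> P" "(e n, b) \<in> P"
      by blast
    from n obtain m where "n = Suc m"
      by (cases n) auto
    with de show "\<exists>m. (c, b) \<in> (P O R) ^^ Suc m O P"
      unfolding relpow_relcomp_conv_alternating by blast
  qed
  finally show ?thesis .
qed

definition chain_preorder :: "'a set \<Rightarrow> ('a \<times> 'a) set \<Rightarrow> ('a \<times> 'a) set \<Rightarrow> ('a \<times> 'a) set" where
  "chain_preorder X P R = {(a, b) \<in> X \<times> X. under P a \<subseteq> {c. (c, b) \<in> (P O R)\<^sup>* O P}}"

lemma (in W_set) admissible_chain_preorder:
  assumes "left_continuous prec R"
  shows "admissible_preorder X prec R (chain_preorder X prec R)" (is "admissible_preorder _ _ _ ?S")
  unfolding admissible_preorder_def preorder_on_def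
proof (intro conjI ballI impI)
  show "?S \<subseteq> X \<times> X"
    by (auto simp: chain_preorder_def)
  show "refl_on X ?S"
    by (auto simp: refl_on_def chain_preorder_def under_def)
  show "trans ?S"
  proof (rule transI)
    fix a b c
    assume ab: "(a, b) \<in> ?S" and bc: "(b, c) \<in> ?S"
    have "(x, c) \<in> (prec O R)\<^sup>* O prec" if "(x, a) \<in> prec" for x
    proof -
      from ab that obtain y where y: "(x, y) \<in> (prec O R)\<^sup>*" "(y, b) \<in> prec"
        by (auto simp: chain_preorder_def under_def)
      \<comment> \<open>Since \<open>y\<close> lies below \<open>b\<close>, the last link of the
        first chain can be replaced by the chain that \<open>bc\<close> provides from
        \<open>y\<close> to \<open>c\<close>.\<close>
      with bc obtain z where "(y, z) \<in> (prec O R)\<^sup>*" "(z, c) \<in> prec"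
        by (auto simp: chain_preorder_def under_def)
      with y(1) show ?thesis
        by (blast intro: rtrancl_trans)
    qed
    with ab bc show "(a, c) \<in> ?S"
      by (auto simp: chain_preorder_def under_def)
  qed
next
  fix a b
  assume "a \<in> X" "b \<in> X"
  show "(a, b) \<in> ?S" if "under prec a \<subseteq> under prec b"
    using that \<open>a \<in> X\<close> \<open>b \<in> X\<close> by (auto simp: chain_preorder_def under_def)
  show "(a, b) \<in> ?S" if "(a, b) \<in> R"
  proof -
    have "(c, b) \<in> (prec O R)\<^sup>* O prec" if "(c, a) \<in> prec" for c
    proof -
      \<comment> \<open>Left continuity supplies the final \<open>prec\<close> link that
        \<open>c \<prec> a R b\<close> lacks, making a chain with \<open>n = 1\<close>.\<close>
      from that \<open>(a, b) \<in> R\<close> assms have "(c, b) \<in> prec O R O prec"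
        unfolding left_continuous_def by blast
      then show ?thesis
        by blast
    qed
    then show ?thesis
      using \<open>a \<in> X\<close> \<open>b \<in> X\<close> by (auto simp: chain_preorder_def under_def)
  qed
  show "(a, b) \<in> ?S" if below: "\<forall>c \<in> under prec a. (c, b) \<in> ?S"
  proof -
    have "(c, b) \<in> (prec O R)\<^sup>* O prec" if "(c, a) \<in> prec" for c
    proof -
      \<comment> \<open>The interpolant \<open>u\<close> is a member of the sequence for
        \<open>a\<close> that lies above \<open>c\<close>; the hypothesis \<open>below\<close> is
        then used at \<open>u\<close>.\<close>
      from W1[OF \<open>a \<in> X\<close>] that obtain u where "(c, u) \<in> prec" "(u, a) \<in> prec"
        unfolding under_def by blast
      with below show ?thesis
        by (auto simp: chain_preorder_def under_def)
    qed
    then show ?thesis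
      using \<open>a \<in> X\<close> \<open>b \<in> X\<close> by (auto simp: chain_preorder_def under_def)
  qed
qed

lemma (in W_set) chain_preorder_subset_admissible:
  assumes "R \<subseteq> X \<times> X" and adm: "admissible_preorder X prec R S"
  shows "chain_preorder X prec R \<subseteq> S"
proof -
  have "trans S" "refl_on X S"
    using adm by (auto simp: admissible_preorder_def preorder_on_def)
  have "prec \<subseteq> S"
  proof (rule subrelI)
    fix x y
    assume xy: "(x, y) \<in> prec"
    \<comment> \<open>Transitivity of \<open>prec\<close> makes the first closure rule
      applicable.\<close>
    then have "under prec x \<subseteq> under prec y"
      using prec_trans by (auto simp: under_def dest: transD)
    with xy prec_on adm show "(x, y) \<in> S"
      unfolding admissible_preorder_def by blast
  qed
  moreover have "R \<subseteq> S"
    using assms unfolding admissible_preorder_def by blast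
  ultimately have "prec O R \<subseteq> S"
    using \<open>trans S\<close> by (blast dest: transD)
  \<comment> \<open>Induction peels \<open>prec O R\<close> links off the left end; only the final
    \<open>prec\<close> link remains in the base case.\<close>
  have "(c, b) \<in> S" if "(c, y) \<in> (prec O R)\<^sup>*" "(y, b) \<in> prec" for c y b
    using that
  proof (induction rule: converse_rtrancl_induct)
    case base
    with \<open>prec \<subseteq> S\<close> show ?case by blast
  next
    case (step x z)
    with \<open>prec O R \<subseteq> S\<close> \<open>trans S\<close> show ?case by (blast dest: transD)
  qed
  then show ?thesis
    using adm by (fastforce simp: chain_preorder_def admissible_preorder_def)
qed

lemma (in W_set) leq_rel_eq_chain_preorder:
  assumes "R \<subseteq> X \<times> X" and "left_continuous prec R"
  shows "leq_rel X prec R = chain_preorder X prec R"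
  using leq_rel_least[OF admissible_chain_preorder[OF assms(2)]]
    chain_preorder_subset_admissible[OF assms(1) leq_rel_admissible]
  by (rule equalityI)

theorem theorem6p2:
  fixes X :: "'a set" and zero :: 'a and prec R :: "('a \<times> 'a) set" and a b :: 'a
  assumes "W_set X zero prec"
    and "R \<subseteq> X \<times> X"
    and "left_continuous prec R"
    and "a \<in> X" and "b \<in> X"
  shows "(a, b) \<in> leq_rel X prec R \<longleftrightarrow>
    (\<forall>c\<in>X. (c, a) \<in> prec \<longrightarrow>
       (c, b) \<in> prec \<or>
       (\<exists>(n::nat) (d :: nat \<Rightarrow> 'a) (e :: nat \<Rightarrow> 'a).
          n \<ge> 1 \<and>
          (\<forall>i\<in>{1..n}. d i \<in> X \<and> e i \<in> X) \<and>
          (c, d 1) \<in> prec \<and>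
          (\<forall>i\<in>{1..n}. (d i, e i) \<in> R) \<and>
          (\<forall>i\<in>{1..<n}. (e i, d (i + 1)) \<in> prec) \<and>
          (e n, b) \<in> prec))"
proof -
  interpret W_set X zero prec by fact
  \<comment> \<open>Everything below \<open>a\<close> lies in \<open>X\<close>, so letting
    \<open>c\<close> range over \<open>X\<close> agrees with letting it range over
    \<open>under prec a\<close>.\<close>
  have "(a, b) \<in> leq_rel X prec R \<longleftrightarrow> (\<forall>c\<in>X. (c, a) \<in> prec \<longrightarrow> (c, b) \<in> (prec O R)\<^sup>* O prec)"
    using assms(4,5) prec_on
    by (auto simp: leq_rel_eq_chain_preorder[OF assms(2,3)] chain_preorder_def under_def)
  then show ?thesis
    unfolding rtrancl_relcomp_conv_alternating[OF assms(2)] .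
qed

end
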